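(* Let $n\ge 4$ and $b\ge 2$, and let $\mathcal{R}[N]$ be the principal submatrix of $\mathcal{R}=\mathcal{R}(T_n^{(b)})$ corresponding to the vertex set $N$. Then the eigenvalues of $\mathcal{R}[N]$ are: $-(n-4)(n-6)b$ with multiplicity $1$; $(2n-9)b$ with multiplicity $b-1$; and $(n-6)b$ with multiplicity $(n-4)b$.
   Context: Let $n\ge 4$, $b\ge 2$. $I_m$ is the identity matrix of order $m$, $J_{p\times q}$ is the $p\times q$ all-ones matrix, $J_m=J_{m\times m}$, $\mathbf{1}_m$ is the all-ones column vector of length $m$, and $\mathcal{A}_2=\begin{bmatrix}0&1\\1&0\end{bmatrix}$. For a matrix $A$ and index set $S$, $A[S]$ denotes the principal submatrix of $A$ with rows and columns indexed by $S$. Graph and indexing (motivation for the index sets). $T_n$ is the graph on $n$ vertices formed by $n-2$ triangles sharing a common base edge; $T_n^{(b)}$ is obtained from $b$ copies of $T_n$ by identifying one non-base vertex of each copy into a central cut vertex $c$. Its vertices are $1,\dots,b(n-1)+1$ with $c=b(n-1)+1$; in the $k$-th block the vertices $(k-1)(n-1)+i$ with $i=1,2$ are the base vertices and those with $3\le i\le n-1$ are the non-base vertices other than $c$. The set of non-base vertices excluding $c$ is $$N=\{(k-1)(n-1)+i : k=1,\dots,b,\ i=3,4,\dots,n-1\}.$$ The matrix $\mathcal{R}(T_n^{(b)})$ (for $n\ge 4$) is the symmetric $(b+1)\times(b+1)$ block matrix of order $b(n-1)+1$ (first $b$ block-rows and block-columns of size $n-1$, last one of size $1$) whose first $b$ diagonal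 blocks are $\mathcal{R}_1$, whose off-diagonal $(i,j)$ blocks with $1\le i\neq j\le b$ are $\mathcal{R}_2$, whose $(i,b+1)$ blocks are $\mathbf{r}_3$ and $(b+1,i)$ blocks are $\mathbf{r}_3^t$ for $1\le i\le b$, and whose $(b+1,b+1)$ block is the scalar $r$, where $$\mathcal{R}_1=\begin{bmatrix}(n-5)(n-2)(b-1)I_2+(n-2)(b-(n-5))\mathcal{A}_2 & -((n-4)b-2)J_{2\times(n-3)}\\ -((n-4)b-2)J_{(n-3)\times 2} & b(n-6)I_{n-3}+(b-(n-5))J_{n-3}\end{bmatrix},$$ $$\mathcal{R}_2=\begin{bmatrix}-(n-5)(n-2)J_2 & 2J_{2\times(n-3)}\\ 2J_{(n-3)\times 2} & -(n-5)J_{n-3}\end{bmatrix},\qquad \mathbf{r}_3=\begin{bmatrix}(n-6)[(n-4)b-(n-3)]\mathbf{1}_2\\ -b(n-6)\mathbf{1}_{n-3}\end{bmatrix},$$ $$r=-(n-5)(n-6)(b-1)^2.$$ Multiplicities of listed values are to be added whenever listed values coincide (i.e. the list describes the roots of the characteristic polynomial); a value listed with multiplicity $0$ is absent from the list. *)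

theory Defs
  imports
    "HOL-Computational_Algebra.Polynomial"
    "Jordan_Normal_Form.Char_Poly"
    "Jordan_Normal_Form.DL_Submatrix"
begin

definition ones_mat :: "nat \<Rightarrow> nat \<Rightarrow> real mat" where
  "ones_mat p q = mat p q (\<lambda>_. 1)"

definition ones_vec :: "nat \<Rightarrow> real vec" where
  "ones_vec m = vec m (\<lambda>_. 1)"

definition A2 :: "real mat" where
  "A2 = mat_of_rows_list 2 [[0, 1], [1, 0]]"

text \<open>In the entries below the parameters are coerced to reals before subtracting
  (for instance \<open>real n - 5\<close> is negative for \<open>n = 4\<close>); natural-number subtraction
  occurs only in dimensions.\<close>

definition R1 :: "nat \<Rightarrow> nat \<Rightarrow> real mat" where
  "R1 n b = four_block_mat
     (((real n - 5) * (real n - 2) * (real b - 1)) \<cdot>\<^sub>m 1\<^sub>m 2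
        + ((real n - 2) * (real b - (real n - 5))) \<cdot>\<^sub>m A2)
     ((- ((real n - 4) * real b - 2)) \<cdot>\<^sub>m ones_mat 2 (n - 3))
     ((- ((real n - 4) * real b - 2)) \<cdot>\<^sub>m ones_mat (n - 3) 2)
     ((real b * (real n - 6)) \<cdot>\<^sub>m 1\<^sub>m (n - 3)
        + (real b - (real n - 5)) \<cdot>\<^sub>m ones_mat (n - 3) (n - 3))"

definition R2 :: "nat \<Rightarrow> real mat" where
  "R2 n = four_block_mat
     ((- ((real n - 5) * (real n - 2))) \<cdot>\<^sub>m ones_mat 2 2)
     (2 \<cdot>\<^sub>m ones_mat 2 (n - 3))
     (2 \<cdot>\<^sub>m ones_mat (n - 3) 2)
     ((- (real n - 5)) \<cdot>\<^sub>m ones_mat (n - 3) (n - 3))"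

definition r3 :: "nat \<Rightarrow> nat \<Rightarrow> real vec" where
  "r3 n b =
     ((real n - 6) * ((real n - 4) * real b - (real n - 3))) \<cdot>\<^sub>v ones_vec 2
     @\<^sub>v (- (real b * (real n - 6))) \<cdot>\<^sub>v ones_vec (n - 3)"

definition r_corner :: "nat \<Rightarrow> nat \<Rightarrow> real" where
  "r_corner n b = - ((real n - 5) * (real n - 6) * (real b - 1)\<^sup>2)"

text \<open>With 0-based indices \<open>i < b (n - 1)\<close>, the row \<open>i\<close> lies in block-row
  \<open>i div (n - 1)\<close> at position \<open>i mod (n - 1)\<close>; similarly for columns.\<close>

definition R_mat :: "nat \<Rightarrow> nat \<Rightarrow> real mat" where
  "R_mat n b = four_block_mat
     (mat (b * (n - 1)) (b * (n - 1))
        (\<lambda>(i, j). (if i div (n - 1) = j div (n - 1) then R1 n b else R2 n)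
                   $$ (i mod (n - 1), j mod (n - 1))))
     (mat (b * (n - 1)) 1 (\<lambda>(i, _). r3 n b $ (i mod (n - 1))))
     (mat 1 (b * (n - 1)) (\<lambda>(_, j). r3 n b $ (j mod (n - 1))))
     (mat 1 1 (\<lambda>_. r_corner n b))"

text \<open>The non-base vertices other than the central cut vertex in the graph obtained from
  \<open>b\<close> copies of \<open>n - 2\<close> triangles on a common base edge by identifying one non-base
  vertex of each copy. Vertices are numbered \<open>1, \<dots>, b (n - 1) + 1\<close>; the cut vertex is
  the last one, and the first two vertices of every block are its base vertices.\<close>

definition nonbase :: "nat \<Rightarrow> nat \<Rightarrow> nat set" where
  "nonbase n b = {(k - 1) * (n - 1) + i | k i. k \<in> {1..b} \<and> i \<in> {3..n - 1}}"

text \<open>\<open>submatrix\<close> uses 0-based row and column indices, so vertex \<open>v\<close> is row and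
  column \<open>v - 1\<close>.\<close>

definition principal_submatrix :: "'a mat \<Rightarrow> nat set \<Rightarrow> 'a mat" where
  "principal_submatrix A S = submatrix A ((\<lambda>v. v - 1) ` S) ((\<lambda>v. v - 1) ` S)"

text \<open>The eigenvalues of a real square matrix, with algebraic multiplicity: all complex
  roots of its characteristic polynomial.\<close>

definition eigenvalue_mset :: "real mat \<Rightarrow> complex multiset" where
  "eigenvalue_mset A = proots (char_poly (map_mat complex_of_real A))"

end

theory Submission
  imports Defs
begin

text \<open>
  Put \<open>m = n - 3\<close>. Restricting the matrix to the non-base vertices keeps, in every diagonal
  block, the corner \<open>b (n - 6) I + (b - (n - 5)) J\<close> and, in every other block, the
  corner \<open>- (n - 5) J\<close>. So the restricted matrix is
  \<open>\<alpha> I + \<beta> (I \<otimes> J) + \<sigma> J\<close>, where \<open>\<alpha> = b (n - 6)\<close>, \<open>\<beta> = b\<close>, \<open>\<sigma> = - (n - 5)\<close>,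
  the Kronecker product is that of \<open>I\<close> of order \<open>b\<close> with \<open>J\<close> of order \<open>m\<close>, and the last \<open>J\<close>
  has order \<open>b m\<close>. The three summands commute: vectors with sum zero on each block have
  eigenvalue \<open>\<alpha>\<close> (dimension \<open>b (m - 1)\<close>), vectors that are constant on blocks with total sum
  zero have \<open>\<alpha> + m \<beta>\<close> (dimension \<open>b - 1\<close>), and the all-ones vector has
  \<open>\<alpha> + m \<beta> + b m \<sigma>\<close>.

  The proof reads the same decomposition off the characteristic polynomial, so that algebraic
  multiplicities come out directly, including when eigenvalues coincide. A matrix that is constant
  on blocks factors through the \<open>b\<close>-dimensional space of block-constant vectors. Sylvester's
  determinant identity, \<open>sylvester_det_identity\<close>, therefore trades its characteristic
  polynomial for that of the \<open>b \<times> b\<close> matrix of block values times \<open>m\<close>; this is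
  \<open>det_blow_up\<close>. The \<open>b \<times> b\<close> matrix is a multiple of \<open>I\<close> plus a multiple of \<open>J\<close>, and
  \<open>J\<close> is a single constant block, so the same reduction applies once more and ends
  with a \<open>1 \<times> 1\<close> determinant (\<open>char_poly_nested_constant_blocks\<close>). It remains to identify the
  submatrix (\<open>principal_submatrix_nonbase\<close>) and to evaluate the three roots.
\<close>

section \<open>Determinants of block-constant matrices\<close>

text \<open>Both sides are \<open>x ^ q\<close> times the determinant of the block matrix with rows \<open>(x I, U)\<close>
  and \<open>(V, I)\<close>: multiplying on the right by a block triangular matrix of determinant \<open>1\<close> clears \<open>V\<close> and
  leaves \<open>x I - U V\<close>, while multiplying on the left by one of determinant \<open>x ^ q\<close> clears \<open>V\<close> and
  leaves \<open>x I - V U\<close>. Without division by \<open>x\<close> the identity holds in every integral domain,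
  in particular for \<open>x\<close> a linear polynomial.\<close>

lemma sylvester_det_identity:
  fixes x :: "'a :: idom"
  assumes U: "U \<in> carrier_mat p q" and V: "V \<in> carrier_mat q p"
  shows "x ^ q * det (x \<cdot>\<^sub>m 1\<^sub>m p - U * V) = x ^ p * det (x \<cdot>\<^sub>m 1\<^sub>m q - V * U)"
proof -
  let ?M = "four_block_mat (x \<cdot>\<^sub>m 1\<^sub>m p) U V (1\<^sub>m q)"
  let ?L = "four_block_mat (1\<^sub>m p) (0\<^sub>m p q) (- V) (x \<cdot>\<^sub>m 1\<^sub>m q)"
  let ?R = "four_block_mat (1\<^sub>m p) (0\<^sub>m p q) (- V) (1\<^sub>m q)"
  have M: "?M \<in> carrier_mat (p + q) (p + q)"
    and L: "?L \<in> carrier_mat (p + q) (p + q)"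
    and R: "?R \<in> carrier_mat (p + q) (p + q)"
    by auto
  have UV: "U * V \<in> carrier_mat p p" and VU: "V * U \<in> carrier_mat q q"
    using U V by auto
  have negU: "U * (- V) = - (U * V)"
    using U V by (simp add: uminus_mult_right_mat)
  have negV: "(- V) * U = - (V * U)"
    using U V by (simp add: uminus_mult_left_mat)
  have detR: "det ?R = 1"
    using V by (subst det_four_block_mat_upper_right_zero[of _ p _ q]) auto
  have detL: "det ?L = x ^ q"
    using V by (subst det_four_block_mat_upper_right_zero[of _ p _ q]) auto
  have MR: "?M * ?R = four_block_mat (x \<cdot>\<^sub>m 1\<^sub>m p - U * V) U (0\<^sub>m q p) (1\<^sub>m q)"
    using U V negU UV
    by (subst mult_four_block_mat[of _ p p _ q _ q _ _ p _ q]) (auto simp: minus_add_uminus_mat)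
  have LM: "?L * ?M = four_block_mat (x \<cdot>\<^sub>m 1\<^sub>m p) U (0\<^sub>m q p) (x \<cdot>\<^sub>m 1\<^sub>m q - V * U)"
    using U V negV VU
    by (subst mult_four_block_mat[of _ p p _ q _ q _ _ p _ q]) (auto intro!: cong_four_block_mat)
  have "det (x \<cdot>\<^sub>m 1\<^sub>m p - U * V) = det (?M * ?R)"
    unfolding MR using U V by (subst det_four_block_mat_lower_left_zero[of _ p _ q]) auto
  also have "\<dots> = det ?M"
    by (simp add: det_mult[OF M R] detR)
  finally have "x ^ q * det (x \<cdot>\<^sub>m 1\<^sub>m p - U * V) = det (?L * ?M)"
    by (simp add: det_mult[OF L M] detL)
  also have "\<dots> = x ^ p * det (x \<cdot>\<^sub>m 1\<^sub>m q - V * U)"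
    unfolding LM using U V by (subst det_four_block_mat_lower_left_zero[of _ p _ q]) auto
  finally show ?thesis .
qed

text \<open>The block-constant matrix is \<open>U V\<close> with \<open>U\<close> the incidence matrix of indices and
  blocks. In \<open>V U\<close> each block value is added up over the \<open>m\<close> columns of its block, which is
  where the factor \<open>m\<close> comes from.\<close>

lemma det_blow_up:
  fixes x :: "'a :: idom" and f :: "nat \<Rightarrow> nat \<Rightarrow> 'a"
  assumes m: "m > 0"
  shows "x ^ b * det (x \<cdot>\<^sub>m 1\<^sub>m (b * m) - mat (b * m) (b * m) (\<lambda>(i, j). f (i div m) (j div m)))
       = x ^ (b * m) * det (x \<cdot>\<^sub>m 1\<^sub>m b - mat b b (\<lambda>(i, j). of_nat m * f i j))"
proof -
  define U where "U = mat (b * m) b (\<lambda>(i, j). if j = i div m then 1 else 0 :: 'a)"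
  define V where "V = mat b (b * m) (\<lambda>(i, j). f i (j div m))"
  have U: "U \<in> carrier_mat (b * m) b" and V: "V \<in> carrier_mat b (b * m)"
    by (auto simp: U_def V_def)
  have div: "i div m < b" if "i < b * m" for i
    using that by (simp add: less_mult_imp_div_less)
  have "U * V = mat (b * m) (b * m) (\<lambda>(i, j). f (i div m) (j div m))"
    by (rule eq_matI)
      (auto simp: U_def V_def scalar_prod_def div if_distrib[of "\<lambda>t. t * _"] cong: if_cong)
  moreover have "V * U = mat b b (\<lambda>(i, j). of_nat m * f i j)"
  proof (rule eq_matI)
    fix i j
    assume "i < dim_row (mat b b (\<lambda>(i, j). of_nat m * f i j))"
      and "j < dim_col (mat b b (\<lambda>(i, j). of_nat m * f i j))"
    then have ij: "i < b" "j < b" by auto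
    have "Suc j * m \<le> b * m"
      using ij by (intro mult_le_mono1) simp
    then have bound: "k < b * m" if "k < Suc j * m" for k
      using that by (rule less_le_trans[rotated])
    have "k div m = j \<longleftrightarrow> j * m \<le> k \<and> k < Suc j * m" for k
    proof -
      have "k div m = j \<longleftrightarrow> j \<le> k div m \<and> k div m < Suc j"
        by (simp only: less_Suc_eq_le) (metis le_antisym order_refl)
      then show ?thesis
        by (simp only: less_eq_div_iff_mult_less_eq[OF m] div_less_iff_less_mult[OF m])
    qed
    then have block: "{k \<in> {0..<b * m}. k div m = j} = {j * m..<Suc j * m}"
      using bound by (auto simp only: mem_Collect_eq atLeastLessThan_iff)
    have "(V * U) $$ (i, j) = (\<Sum>k = 0..<b * m. V $$ (i, k) * U $$ (k, j))"
      using ij U V by (simp add: scalar_prod_def)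
    also have "\<dots> = (\<Sum>k = 0..<b * m. if k div m = j then f i j else 0)"
    proof (rule sum.cong[OF refl])
      fix k assume "k \<in> {0..<b * m}"
      then show "V $$ (i, k) * U $$ (k, j) = (if k div m = j then f i j else 0)"
        using ij by (cases "k div m = j") (simp_all add: U_def V_def)
    qed
    also have "\<dots> = (\<Sum>k \<in> {k \<in> {0..<b * m}. k div m = j}. f i j)"
      by (rule sum.inter_filter[symmetric]) simp
    also have "\<dots> = of_nat m * f i j"
      unfolding block by simp
    finally show "(V * U) $$ (i, j) = mat b b (\<lambda>(i, j). of_nat m * f i j) $$ (i, j)"
      using ij by simp
  qed (use U V in auto)
  ultimately show ?thesis
    using sylvester_det_identity[OF U V, of x] by simp
qed

text \<open>All of a constant matrix is one block, so \<open>det_blow_up\<close> reduces it to size one.\<close>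

lemma det_scalar_minus_constant_mat:
  fixes x c :: "'a :: idom"
  assumes "b > 0"
  shows "x * det (x \<cdot>\<^sub>m 1\<^sub>m b - mat b b (\<lambda>_. c)) = x ^ b * (x - of_nat b * c)"
proof -
  have "det (x \<cdot>\<^sub>m 1\<^sub>m 1 - mat 1 1 (\<lambda>_. of_nat b * c)) = x - of_nat b * c"
    by (subst det_single) auto
  then show ?thesis
    using det_blow_up[OF assms, of x 1 "\<lambda>_ _. c"]
    by (simp add: case_prod_unfold)
qed

text \<open>Collapsing the blocks of size \<open>m\<close> moves their contribution \<open>m \<beta>\<close> to the diagonal, so the
  scalar \<open>y\<close> becomes \<open>z\<close> and a constant matrix remains. Each of the two reductions multiplies
  the determinant by a power of its scalar; both scalars have to be nonzero to be cancelled.\<close>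

lemma det_nested_constant_blocks:
  fixes y \<beta> \<sigma> :: "'a :: idom" and m b :: nat
  assumes "m > 0" "b > 0" and "y \<noteq> 0"
    and z: "z = y - of_nat m * \<beta>" "z \<noteq> 0"
  shows "det (y \<cdot>\<^sub>m 1\<^sub>m (b * m)
            - mat (b * m) (b * m) (\<lambda>(i, j). if i div m = j div m then \<beta> + \<sigma> else \<sigma>))
       = y ^ (b * (m - 1)) * z ^ (b - 1) * (z - of_nat (b * m) * \<sigma>)" (is "?D = _")
proof -
  have "y ^ b * ?D = y ^ (b * m) *
      det (y \<cdot>\<^sub>m 1\<^sub>m b - mat b b (\<lambda>(i, j). of_nat m * (if i = j then \<beta> + \<sigma> else \<sigma>)))"
    using det_blow_up[OF \<open>m > 0\<close>, of y b "\<lambda>i j. if i = j then \<beta> + \<sigma> else \<sigma>"] by simp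
  also have "y \<cdot>\<^sub>m 1\<^sub>m b - mat b b (\<lambda>(i, j). of_nat m * (if i = j then \<beta> + \<sigma> else \<sigma>))
      = z \<cdot>\<^sub>m 1\<^sub>m b - mat b b (\<lambda>_. of_nat m * \<sigma>)"
    by (rule eq_matI) (auto simp: z algebra_simps)
  finally have "(z * y ^ b) * ?D = y ^ (b * m) * (z * det (z \<cdot>\<^sub>m 1\<^sub>m b - mat b b (\<lambda>_. of_nat m * \<sigma>)))"
    by (simp add: mult_ac)
  also have "\<dots> = y ^ (b * m) * (z ^ b * (z - of_nat (b * m) * \<sigma>))"
    by (simp add: det_scalar_minus_constant_mat[OF \<open>b > 0\<close>] mult_ac)
  also have "y ^ (b * m) = y ^ b * y ^ (b * (m - 1))"
    using \<open>m > 0\<close> by (simp add: right_diff_distrib' flip: power_add)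
  also have "z ^ b = z * z ^ (b - 1)"
    using \<open>b > 0\<close> by (simp add: power_eq_if)
  finally have "(z * y ^ b) * ?D =
      (z * y ^ b) * (y ^ (b * (m - 1)) * z ^ (b - 1) * (z - of_nat (b * m) * \<sigma>))"
    by (simp add: mult_ac)
  then show ?thesis
    using \<open>y \<noteq> 0\<close> \<open>z \<noteq> 0\<close> by simp
qed

lemma char_poly_nested_constant_blocks:
  fixes \<alpha> \<beta> \<sigma> :: "'a :: idom"
  assumes "m > 0" "b > 0"
  shows "char_poly (mat (b * m) (b * m)
            (\<lambda>(i, j). (if i = j then \<alpha> else 0) + (if i div m = j div m then \<beta> else 0) + \<sigma>))
       = [:- \<alpha>, 1:] ^ (b * (m - 1)) * [:- (\<alpha> + of_nat m * \<beta>), 1:] ^ (b - 1)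
         * [:- (\<alpha> + of_nat m * \<beta> + of_nat (b * m) * \<sigma>), 1:]"
    (is "char_poly ?A = _")
proof -
  have "char_poly_matrix ?A = [:- \<alpha>, 1:] \<cdot>\<^sub>m 1\<^sub>m (b * m) - mat (b * m) (b * m)
      (\<lambda>(i, j). if i div m = j div m then [:\<beta>:] + [:\<sigma>:] else [:\<sigma>:])" (is "_ = ?B")
  proof (rule eq_matI)
    fix i j
    assume "i < dim_row ?B" "j < dim_col ?B"
    then have "i < b * m" "j < b * m"
      by simp_all
    then show "char_poly_matrix ?A $$ (i, j) = ?B $$ (i, j)"
      by (cases "i = j"; cases "i div m = j div m") (simp_all add: char_poly_matrix_def)
  qed (simp_all add: char_poly_matrix_def)
  then have "char_poly ?A = [:- \<alpha>, 1:] ^ (b * (m - 1)) * [:- (\<alpha> + of_nat m * \<beta>), 1:] ^ (b - 1)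
      * ([:- (\<alpha> + of_nat m * \<beta>), 1:] - of_nat (b * m) * [:\<sigma>:])"
    unfolding char_poly_def
    by (simp only:) (rule det_nested_constant_blocks[OF assms]; simp add: of_nat_poly)
  also have "[:- (\<alpha> + of_nat m * \<beta>), 1:] - of_nat (b * m) * [:\<sigma>:]
      = [:- (\<alpha> + of_nat m * \<beta> + of_nat (b * m) * \<sigma>), 1:]"
    by (simp add: of_nat_poly del: of_nat_mult)
  finally show ?thesis .
qed

section \<open>The submatrix on the non-base vertices\<close>

text \<open>\<^const>\<open>pick\<close> enumerates a set of indices in increasing order, so it agrees with any strictly
  increasing enumeration.\<close>

lemma submatrix_strict_mono_image:
  assumes mono: "strict_mono_on {..<k} f" and bound: "\<And>i. i < k \<Longrightarrow> f i < r"
    and A: "A \<in> carrier_mat r r"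
  shows "submatrix A (f ` {..<k}) (f ` {..<k}) = mat k k (\<lambda>(i, j). A $$ (f i, f j))"
proof -
  let ?S = "f ` {..<k}"
  have inj: "inj_on f {..<k}"
    using mono by (rule strict_mono_on_imp_inj_on)
  have card: "card {i. i < r \<and> i \<in> ?S} = k"
  proof -
    have "{i. i < r \<and> i \<in> ?S} = ?S" using bound by auto
    then show ?thesis by (simp add: card_image[OF inj])
  qed
  have pick: "pick ?S i = f i" if "i < k" for i
  proof -
    have "{a \<in> ?S. a < f i} = f ` {..<i}"
      using that strict_mono_on_less[OF mono] by auto
    also have "card \<dots> = i"
      using that by (subst card_image) (auto intro: inj_on_subset[OF inj])
    finally show ?thesis
      using pick_card_in_set[of "f i" ?S] that by auto
  qed
  show ?thesis
    using A card by (intro eq_matI) (auto simp: submatrix_def pick)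
qed

text \<open>The row of the \<open>p\<close>-th non-base vertex, both counted from zero: the vertices come in groups of
  \<open>n - 3\<close>, and each block of \<open>n - 1\<close> rows begins with its two base vertices.\<close>

definition nonbase_index :: "nat \<Rightarrow> nat \<Rightarrow> nat" where
  "nonbase_index n p = p div (n - 3) * (n - 1) + (2 + p mod (n - 3))"

lemma
  assumes "n \<ge> 4"
  shows nonbase_index_div: "nonbase_index n p div (n - 1) = p div (n - 3)"
    and nonbase_index_mod: "nonbase_index n p mod (n - 1) = 2 + p mod (n - 3)"
proof -
  have "p mod (n - 3) < n - 3"
    using assms by simp
  then have "2 + p mod (n - 3) < n - 1" "n - 1 \<noteq> 0"
    by linarith+
  then show "nonbase_index n p div (n - 1) = p div (n - 3)"
    and "nonbase_index n p mod (n - 1) = 2 + p mod (n - 3)"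
    by (simp_all add: nonbase_index_def del: One_nat_def add_2_eq_Suc)
qed

lemma nonbase_index_less:
  assumes "n \<ge> 4" and "p < b * (n - 3)"
  shows "nonbase_index n p < b * (n - 1)"
proof -
  have "nonbase_index n p div (n - 1) < b"
    using assms by (subst nonbase_index_div) (simp_all add: less_mult_imp_div_less)
  then show ?thesis
    using assms(1) by (simp add: div_less_iff_less_mult)
qed

lemma strict_mono_nonbase_index:
  assumes "n \<ge> 4"
  shows "strict_mono (nonbase_index n)"
proof (rule strict_monoI)
  fix p q :: nat
  assume "p < q"
  show "nonbase_index n p < nonbase_index n q"
  proof (cases "p div (n - 3) = q div (n - 3)")
    case True
    have "q div (n - 3) * (n - 3) + p mod (n - 3) = p"
      using div_mult_mod_eq[of p "n - 3"] by (simp only: True)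
    then have "p mod (n - 3) < q mod (n - 3)"
      using \<open>p < q\<close> div_mult_mod_eq[of q "n - 3"] by linarith
    with True show ?thesis
      by (simp add: nonbase_index_def)
  next
    case False
    then have "p div (n - 3) < q div (n - 3)"
      using \<open>p < q\<close> div_le_mono[of p q "n - 3"] by simp
    then have "nonbase_index n p div (n - 1) < nonbase_index n q div (n - 1)"
      by (simp only: nonbase_index_div[OF assms])
    then show ?thesis
      by (metis div_le_mono linorder_not_less)
  qed
qed

lemma nonbase_eq_image:
  assumes "n \<ge> 4"
  shows "(\<lambda>v. v - 1) ` nonbase n b = nonbase_index n ` {..<b * (n - 3)}" (is "?L = ?R")
proof (intro equalityI subsetI)
  fix v assume "v \<in> ?L"
  then obtain k i where ki: "k \<in> {1..b}" "i \<in> {3..n - 1}" "v = (k - 1) * (n - 1) + i - 1"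
    by (auto simp: nonbase_def)
  define p where "p = (k - 1) * (n - 3) + (i - 3)"
  have "i - 3 < n - 3"
    using ki by auto
  then have "p div (n - 3) = k - 1" "p mod (n - 3) = i - 3"
    by (simp_all add: p_def)
  then have "nonbase_index n p = (k - 1) * (n - 1) + (2 + (i - 3))"
    by (simp only: nonbase_index_def)
  also have "\<dots> = v"
    using ki by (simp del: One_nat_def add_2_eq_Suc)
  finally have "nonbase_index n p = v" .
  moreover have "p div (n - 3) < b"
    using ki \<open>p div (n - 3) = k - 1\<close> by auto
  then have "p < b * (n - 3)"
    using assms by (subst (asm) div_less_iff_less_mult) auto
  ultimately show "v \<in> ?R"
    by auto
next
  fix v assume "v \<in> ?R"
  then obtain p where p: "p < b * (n - 3)" "v = nonbase_index n p"
    by auto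
  have "p div (n - 3) < b" "p mod (n - 3) < n - 3"
    using p assms by (simp_all add: less_mult_imp_div_less)
  moreover have "v = ((Suc (p div (n - 3)) - 1) * (n - 1) + (3 + p mod (n - 3))) - 1"
    by (simp add: p nonbase_index_def)
  ultimately show "v \<in> ?L"
    unfolding nonbase_def
    by (intro image_eqI[of _ _ "(Suc (p div (n - 3)) - 1) * (n - 1) + (3 + p mod (n - 3))"] CollectI
        exI[of _ "Suc (p div (n - 3))"] exI[of _ "3 + p mod (n - 3)"]) auto
qed

lemma R_mat_noncentral_index:
  assumes "p < b * (n - 1)" and "q < b * (n - 1)"
  shows "R_mat n b $$ (p, q) =
    (if p div (n - 1) = q div (n - 1) then R1 n b else R2 n) $$ (p mod (n - 1), q mod (n - 1))"
  using assms by (simp add: R_mat_def)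

lemma
  assumes "s < n - 3" and "t < n - 3"
  shows R1_nonbase_index: "R1 n b $$ (2 + s, 2 + t) =
      (if s = t then real b * (real n - 6) else 0) + (real b - (real n - 5))"
    and R2_nonbase_index: "R2 n $$ (2 + s, 2 + t) = - (real n - 5)"
  using assms by (simp_all add: R1_def R2_def A2_def mat_of_rows_list_def ones_mat_def)

text \<open>The diagonal blocks exceed the others by \<open>b (n - 6) I + b J\<close>, so the common value
  \<open>- (n - 5)\<close> can be split off as a constant matrix.\<close>

lemma principal_submatrix_nonbase:
  assumes n: "n \<ge> 4"
  shows "principal_submatrix (R_mat n b) (nonbase n b) =
    mat (b * (n - 3)) (b * (n - 3)) (\<lambda>(i, j).
      (if i = j then real b * (real n - 6) else 0)
      + (if i div (n - 3) = j div (n - 3) then real b else 0) + - (real n - 5))"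
proof -
  have R: "R_mat n b \<in> carrier_mat (b * (n - 1) + 1) (b * (n - 1) + 1)"
    by (auto simp: R_mat_def)
  have "principal_submatrix (R_mat n b) (nonbase n b) =
      mat (b * (n - 3)) (b * (n - 3)) (\<lambda>(i, j). R_mat n b $$ (nonbase_index n i, nonbase_index n j))"
    unfolding principal_submatrix_def nonbase_eq_image[OF n]
    by (rule submatrix_strict_mono_image[OF monotone_on_subset[OF strict_mono_nonbase_index[OF n] subset_UNIV] _ R])
      (simp add: nonbase_index_less[OF n, unfolded One_nat_def] less_SucI)
  also have "\<dots> = mat (b * (n - 3)) (b * (n - 3)) (\<lambda>(i, j).
      (if i = j then real b * (real n - 6) else 0)
      + (if i div (n - 3) = j div (n - 3) then real b else 0) + - (real n - 5))"
  proof (rule cong_mat)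
    fix i j assume ij: "i < b * (n - 3)" "j < b * (n - 3)"
    let ?m = "n - 3"
    have "i mod ?m < ?m" "j mod ?m < ?m"
      using n by simp_all
    note entries = R1_nonbase_index[OF this] R2_nonbase_index[OF this]
    have eq: "i = j \<longleftrightarrow> i div ?m = j div ?m \<and> i mod ?m = j mod ?m"
      by (metis div_mult_mod_eq)
    have "R_mat n b $$ (nonbase_index n i, nonbase_index n j) =
        (if i div ?m = j div ?m then R1 n b else R2 n) $$ (2 + i mod ?m, 2 + j mod ?m)"
      by (simp only: R_mat_noncentral_index nonbase_index_less[OF n] ij
          nonbase_index_div[OF n] nonbase_index_mod[OF n])
    also have "\<dots> = (if i = j then real b * (real n - 6) else 0)
        + (if i div ?m = j div ?m then real b else 0) + - (real n - 5)"
      using entries eq by (cases "i div ?m = j div ?m") (simp_all del: add_2_eq_Suc)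
    finally show "(case (i, j) of (i, j) \<Rightarrow> R_mat n b $$ (nonbase_index n i, nonbase_index n j)) =
      (case (i, j) of (i, j) \<Rightarrow> (if i = j then real b * (real n - 6) else 0)
      + (if i div (n - 3) = j div (n - 3) then real b else 0) + - (real n - 5))"
      by simp
  qed auto
  finally show ?thesis .
qed

section \<open>The spectrum\<close>

theorem theorem4p3:
  fixes n b :: nat
  assumes "n \<ge> 4" and "b \<ge> 2"
  shows "eigenvalue_mset (principal_submatrix (R_mat n b) (nonbase n b)) =
    image_mset complex_of_real
      ({# - ((real n - 4) * (real n - 6) * real b) #}
       + replicate_mset (b - 1) ((2 * real n - 9) * real b)
       + replicate_mset ((n - 4) * b) ((real n - 6) * real b))"
proof -
  define m where "m = n - 3"
  define \<alpha> \<beta> \<sigma> where "\<alpha> = complex_of_real (real b * (real n - 6))"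
    and "\<beta> = complex_of_real (real b)" and "\<sigma> = complex_of_real (- (real n - 5))"
  define \<mu> \<nu> where "\<mu> = \<alpha> + of_nat m * \<beta>" and "\<nu> = \<mu> + of_nat (b * m) * \<sigma>"
  have m: "m > 0" "of_nat m = complex_of_real (real n - 3)"
    using assms by (auto simp: m_def)
  have \<mu>: "\<mu> = complex_of_real ((2 * real n - 9) * real b)"
    by (simp add: \<mu>_def \<alpha>_def \<beta>_def m algebra_simps)
  have \<nu>: "\<nu> = complex_of_real (- ((real n - 4) * (real n - 6) * real b))"
    by (simp add: \<nu>_def \<mu>_def \<alpha>_def \<beta>_def \<sigma>_def m algebra_simps)
  have mult: "b * (m - 1) = (n - 4) * b"
    by (simp add: m_def)
  have "map_mat complex_of_real (principal_submatrix (R_mat n b) (nonbase n b)) =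
      mat (b * m) (b * m)
        (\<lambda>(i, j). (if i = j then \<alpha> else 0) + (if i div m = j div m then \<beta> else 0) + \<sigma>)"
    unfolding principal_submatrix_nonbase[OF \<open>n \<ge> 4\<close>] m_def[symmetric]
    by (rule eq_matI) (auto simp: \<alpha>_def \<beta>_def \<sigma>_def)
  then have "eigenvalue_mset (principal_submatrix (R_mat n b) (nonbase n b)) =
      proots ([:- \<alpha>, 1:] ^ (b * (m - 1)) * [:- \<mu>, 1:] ^ (b - 1) * [:- \<nu>, 1:])"
    using char_poly_nested_constant_blocks[OF \<open>m > 0\<close>, of b \<alpha> \<beta> \<sigma>] assms
    unfolding eigenvalue_mset_def \<nu>_def \<mu>_def by simp
  \<comment> \<open>Adding the root multisets of the three factors merges the multiplicities whenever
    two of \<open>\<alpha>\<close>, \<open>\<mu>\<close>, \<open>\<nu>\<close> coincide.\<close>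
  also have "\<dots> = replicate_mset (b * (m - 1)) \<alpha> + replicate_mset (b - 1) \<mu> + {# \<nu> #}"
    by (subst proots_mult, simp, simp)+ (simp add: proots_power)
  finally show ?thesis
    unfolding \<mu> \<nu> mult by (simp add: \<alpha>_def mult_ac)
qed

end
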